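(* Let $a<b$ be positive integers and let $K_{a,b}$ be the complete bipartite graph with parts of sizes $a$ and $b$. Then $$1+\left\lceil \frac{b}{a}\right\rceil \leq \check s(K_{a,b}) \leq 1+\frac{b}{\gcd(a,b)}.$$
   Context: For a proper edge coloring $\varphi$ of a graph $G$, the palette of a vertex $v$ is the set of colors on edges incident with $v$. The palette index $\check s(G)$ is the minimum number of distinct palettes over all proper edge colorings of $G$. *)

theory Defs
  imports Complex_Main
begin

text \<open>
  A simple graph is given by a vertex set \<open>V\<close> and a set \<open>E\<close> of two-element edges \<open>{u, v}\<close>.
  Colors are natural numbers, which is enough for finite graphs: a coloring by any other set uses
  finitely many colors, and renaming them injectively preserves properness and the number of
  distinct palettes.
\<close>

definition proper_edge_coloring :: "'v set set \<Rightarrow> ('v set \<Rightarrow> nat) \<Rightarrow> bool" where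
  "proper_edge_coloring E \<phi> \<longleftrightarrow>
     (\<forall>e\<in>E. \<forall>f\<in>E. e \<noteq> f \<and> e \<inter> f \<noteq> {} \<longrightarrow> \<phi> e \<noteq> \<phi> f)"

definition palette :: "'v set set \<Rightarrow> ('v set \<Rightarrow> nat) \<Rightarrow> 'v \<Rightarrow> nat set" where
  "palette E \<phi> v = \<phi> ` {e \<in> E. v \<in> e}"

text \<open>
  On a finite graph the infimum is an attained minimum, since giving distinct colors to all
  edges is a proper coloring.
\<close>

definition palette_index :: "'v set \<Rightarrow> 'v set set \<Rightarrow> nat" where
  "palette_index V E = Inf {card (palette E \<phi> ` V) | \<phi>. proper_edge_coloring E \<phi>}"

definition complete_bipartite_edges :: "'v set \<Rightarrow> 'v set \<Rightarrow> 'v set set" where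
  "complete_bipartite_edges A B = {{x, y} | x y. x \<in> A \<and> y \<in> B}"

end

theory Submission
  imports Defs "HOL-Number_Theory.Cong"
begin

text \<open>
  Vertices of \<open>A\<close> have palettes of size \<open>b\<close> and vertices of \<open>B\<close> have palettes of size \<open>a\<close>, so the
  two kinds never coincide; and the palette of a vertex of \<open>A\<close> is covered by the palettes occurring
  on \<open>B\<close>, so at least \<open>b / a\<close> of the latter are needed. For the upper bound put \<open>g = gcd a b\<close> and
  \<open>m = b / g\<close>, and colour the edges by the first \<open>a\<close> rows of the \<open>b \<times> b\<close> Latin square obtained
  from the addition table of \<open>\<int>/m\<close> by replacing every entry with a \<open>g \<times> g\<close> cyclic Latin square.
  Every row contains all \<open>b\<close> colours, and since \<open>g\<close> divides \<open>a\<close> the colours in a column depend only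
  on its block, so there are at most \<open>m\<close> palettes on \<open>B\<close>.
\<close>

lemma complete_bipartite_edges_commute:
  "complete_bipartite_edges A B = complete_bipartite_edges B A"
  unfolding complete_bipartite_edges_def by (auto simp: insert_commute)

lemma palette_complete_bipartite:
  assumes "A \<inter> B = {}" and "x \<in> A"
  shows "palette (complete_bipartite_edges A B) \<phi> x = (\<lambda>y. \<phi> {x, y}) ` B"
proof -
  have "{e \<in> complete_bipartite_edges A B. x \<in> e} = (\<lambda>y. {x, y}) ` B"
    using assms unfolding complete_bipartite_edges_def by auto
  then show ?thesis
    unfolding palette_def by (simp add: image_image)
qed

text \<open>Any two edges at \<open>x\<close> meet in \<open>x\<close>, so a proper colouring is
  injective on the star of \<open>x\<close>.\<close>

lemma card_palette_complete_bipartite: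
  assumes "A \<inter> B = {}" and "x \<in> A"
    and "proper_edge_coloring (complete_bipartite_edges A B) \<phi>"
  shows "card (palette (complete_bipartite_edges A B) \<phi> x) = card B"
proof -
  have "inj_on (\<lambda>y. \<phi> {x, y}) B"
  proof (rule inj_onI, rule ccontr)
    fix y z assume yz: "y \<in> B" "z \<in> B" "\<phi> {x, y} = \<phi> {x, z}" "y \<noteq> z"
    have "{x, y} \<in> complete_bipartite_edges A B" "{x, z} \<in> complete_bipartite_edges A B"
      using yz assms(2) unfolding complete_bipartite_edges_def by auto
    moreover have "{x, y} \<noteq> {x, z} \<and> {x, y} \<inter> {x, z} \<noteq> {}"
      using yz by (auto simp: doubleton_eq_iff)
    ultimately have "\<phi> {x, y} \<noteq> \<phi> {x, z}"
      using assms(3) unfolding proper_edge_coloring_def by metis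
    with yz show False by simp
  qed
  then show ?thesis
    using assms by (simp add: palette_complete_bipartite card_image)
qed

lemma card_palettes_complete_bipartite_ge:
  assumes "0 < card A" and "card A < card B" and "A \<inter> B = {}"
    and proper: "proper_edge_coloring (complete_bipartite_edges A B) \<phi>"
  shows "1 + \<lceil>real (card B) / real (card A)\<rceil>
    \<le> int (card (palette (complete_bipartite_edges A B) \<phi> ` (A \<union> B)))"
proof -
  let ?E = "complete_bipartite_edges A B"
  let ?P = "palette ?E \<phi>"
  have fin: "finite A" "finite B" using assms(1,2) by (auto intro: card_ge_0_finite)
  obtain x where x: "x \<in> A" using assms(1) by fastforce
  have cA: "card (?P u) = card B" if "u \<in> A" for u
    using card_palette_complete_bipartite[OF assms(3) that proper] .
  have cB: "card (?P v) = card A" if "v \<in> B" for v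
    using card_palette_complete_bipartite[of B A v \<phi>] that assms(3) proper
    by (simp add: complete_bipartite_edges_commute[of A B] Int_commute)
  have "?P x \<subseteq> \<Union> (?P ` B)"
  proof
    fix c assume "c \<in> ?P x"
    then obtain y where y: "y \<in> B" "c = \<phi> {x, y}"
      using palette_complete_bipartite[OF assms(3) x] by auto
    then have "c \<in> ?P y"
      using x unfolding palette_def complete_bipartite_edges_def by blast
    then show "c \<in> \<Union> (?P ` B)" using y by blast
  qed
  moreover have "finite (?P v)" if "v \<in> B" for v
    using cB[OF that] assms(1) by (metis card_ge_0_finite)
  ultimately have "card (?P x) \<le> card (\<Union> (?P ` B))"
    using fin by (intro card_mono) auto
  \<comment> \<open>The sum runs over the distinct palettes rather than over the vertices of
    \<open>B\<close>, so the estimate bounds the number of palettes.\<close>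
  also have "\<dots> \<le> (\<Sum>p\<in>?P ` B. card p)"
    by (rule card_Union_le_sum_card)
  also have "\<dots> = (\<Sum>p\<in>?P ` B. card A)"
    by (intro sum.cong) (auto simp: cB)
  finally have "card B \<le> card (?P ` B) * card A"
    using cA[OF x] by simp
  then have "real (card B) \<le> real (card (?P ` B)) * real (card A)"
    by (metis of_nat_le_iff of_nat_mult)
  then have "real (card B) / real (card A) \<le> real (card (?P ` B))"
    using assms(1) by (simp add: field_simps)
  then have 1: "\<lceil>real (card B) / real (card A)\<rceil> \<le> int (card (?P ` B))"
    by (simp add: ceiling_le_iff)
  \<comment> \<open>The sizes \<open>card B\<close> and \<open>card A\<close> differ, so
    \<open>?P x\<close> is a further palette: the summand 1 of the bound.\<close>
  have "?P x \<notin> ?P ` B" using cA[OF x] cB assms(2) by force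
  then have "Suc (card (?P ` B)) = card (insert (?P x) (?P ` B))"
    using fin by simp
  also have "\<dots> \<le> card (?P ` (A \<union> B))"
    using fin x by (intro card_mono) auto
  finally show ?thesis using 1 by linarith
qed

text \<open>Entry \<open>(i, j)\<close> of the Latin square of order \<open>m * g\<close>. The
  quotient by \<open>g\<close> names the block symbol, taken from the addition table of the integers
  mod \<open>m\<close>; the remainder is the entry of the cyclic square inside the block.\<close>

definition block_color :: "nat \<Rightarrow> nat \<Rightarrow> nat \<Rightarrow> nat \<Rightarrow> nat" where
  "block_color g m i j = ((i div g + j div g) mod m) * g + (i + j) mod g"

lemma block_color_commute: "block_color g m i j = block_color g m j i"
  by (simp add: block_color_def add.commute)

lemma block_color_less:
  assumes "0 < g" and "0 < m"
  shows "block_color g m i j < m * g"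
proof -
  let ?q = "(i div g + j div g) mod m"
  have "block_color g m i j < ?q * g + g"
    using assms by (simp add: block_color_def)
  also have "\<dots> = Suc ?q * g" by simp
  also have "\<dots> \<le> m * g"
    using assms by (intro mult_le_mono1) (simp add: Suc_leI)
  finally show ?thesis .
qed

text \<open>Quotient and remainder of the colour by \<open>g\<close> give two congruences from which
  the contribution of \<open>i\<close> cancels. The bounds put both block indices below
  \<open>m\<close>, turning congruence mod \<open>m\<close> into equality.\<close>

lemma block_color_inj:
  assumes "0 < g" and "j < m * g" and "l < m * g"
    and eq: "block_color g m i j = block_color g m i l"
  shows "j = l"
proof -
  have "block_color g m i j div g = (i div g + j div g) mod m"
    "block_color g m i j mod g = (i + j) mod g" for j
    using assms(1) by (simp_all add: block_color_def)
  then have "[i div g + j div g = i div g + l div g] (mod m)" "[i + j = i + l] (mod g)"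
    using eq unfolding cong_def by metis+
  then have d: "[j div g = l div g] (mod m)" and r: "j mod g = l mod g"
    by (simp_all add: cong_add_lcancel_nat) (simp add: cong_def)
  have "j div g < m" "l div g < m"
    using assms by (simp_all add: less_mult_imp_div_less)
  with d have "j div g = l div g" by (simp add: cong_def)
  with r show ?thesis by (metis div_mult_mod_eq)
qed

text \<open>This works for every common divisor \<open>g\<close> of the two sizes; the greatest one
  makes \<open>m\<close> smallest. As \<open>k \<le> m\<close>, the vertices of \<open>A\<close> can
  index rows of the square.\<close>

lemma card_palettes_complete_bipartite_le:
  assumes "0 < g" and "0 < k" and "k \<le> m"
    and "finite A" and "finite B" and disj: "A \<inter> B = {}"
    and cA: "card A = k * g" and cB: "card B = m * g"
  shows "\<exists>\<phi>. proper_edge_coloring (complete_bipartite_edges A B) \<phi> \<and>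
    card (palette (complete_bipartite_edges A B) \<phi> ` (A \<union> B)) \<le> 1 + m"
proof -
  let ?E = "complete_bipartite_edges A B"
  obtain f where f: "bij_betw f A {0..<k * g}"
    using ex_bij_betw_finite_nat[OF assms(4)] cA by auto
  obtain h where h: "bij_betw h B {0..<m * g}"
    using ex_bij_betw_finite_nat[OF assms(5)] cB by auto
  have f_less: "f x < k * g" if "x \<in> A" for x using bij_betwE[OF f] that by auto
  have h_less: "h y < m * g" if "y \<in> B" for y using bij_betwE[OF h] that by auto
  have km: "k * g \<le> m * g" using assms(3) by simp
  \<comment> \<open>Edges are unordered; since the parts are disjoint, intersecting with each part
    recovers the two endpoints.\<close>
  define \<phi> where "\<phi> e = block_color g m (f (the_elem (e \<inter> A))) (h (the_elem (e \<inter> B)))" for e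
  have \<phi>: "\<phi> {x, y} = block_color g m (f x) (h y)" if "x \<in> A" "y \<in> B" for x y
  proof -
    have "{x, y} \<inter> A = {x}" "{x, y} \<inter> B = {y}" using that disj by auto
    then show ?thesis by (simp add: \<phi>_def)
  qed
  have proper: "proper_edge_coloring ?E \<phi>"
    unfolding proper_edge_coloring_def
  proof (intro ballI impI notI)
    fix d e assume "d \<in> ?E" "e \<in> ?E" and ne: "d \<noteq> e \<and> d \<inter> e \<noteq> {}" and eq: "\<phi> d = \<phi> e"
    then obtain x y u v where xy: "x \<in> A" "y \<in> B" "d = {x, y}"
      and uv: "u \<in> A" "v \<in> B" "e = {u, v}"
      unfolding complete_bipartite_edges_def by blast
    have c: "block_color g m (f x) (h y) = block_color g m (f u) (h v)"
      using eq xy uv \<phi> by simp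
    have "x = u \<or> y = v" using ne xy uv disj by auto
    then show False
    proof
      assume "x = u"
      then have "h y = h v"
        using block_color_inj[OF assms(1) h_less h_less, of y v "f x"] c xy uv by simp
      then have "y = v" using h xy uv by (auto simp: bij_betw_def dest: inj_onD)
      with \<open>x = u\<close> show False using ne xy uv by simp
    next
      assume "y = v"
      then have "block_color g m (h y) (f x) = block_color g m (h y) (f u)"
        using c block_color_commute by metis
      moreover have "f x < m * g" "f u < m * g"
        using f_less xy uv km order_less_le_trans by blast+
      ultimately have "f x = f u"
        using block_color_inj[OF assms(1)] by blast
      then have "x = u" using f xy uv by (auto simp: bij_betw_def dest: inj_onD)
      with \<open>y = v\<close> show False using ne xy uv by simp
    qed
  qed
  \<comment> \<open>There are only \<open>m * g\<close> colours and \<open>x\<close> sees that many,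
    so all of \<open>A\<close> shares one palette.\<close>
  have palA: "palette ?E \<phi> x = {..<m * g}" if x: "x \<in> A" for x
  proof (rule card_seteq)
    show "palette ?E \<phi> x \<subseteq> {..<m * g}"
      using x \<phi> assms(1-3) by (auto simp: palette_complete_bipartite[OF disj] block_color_less)
    show "card {..<m * g} \<le> card (palette ?E \<phi> x)"
      using card_palette_complete_bipartite[OF disj x proper] cB by simp
  qed simp
  \<comment> \<open>The colours met in column block \<open>j\<close>: \<open>i\<close> runs over the
    row blocks and \<open>r\<close> over all residues, since each row block is complete.\<close>
  define Q where "Q j = (\<lambda>(i, r). ((i + j) mod m) * g + r) ` ({..<k} \<times> {..<g})" for j
  have palB: "palette ?E \<phi> y = Q (h y div g)" if y: "y \<in> B" for y
  proof (rule card_seteq)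
    have disj': "B \<inter> A = {}" using disj by blast
    have pal: "palette ?E \<phi> y = (\<lambda>x. \<phi> {x, y}) ` A"
      using palette_complete_bipartite[OF disj' y, of \<phi>]
      by (simp add: complete_bipartite_edges_commute[of A B] insert_commute)
    show "palette ?E \<phi> y \<subseteq> Q (h y div g)"
    proof
      fix c assume "c \<in> palette ?E \<phi> y"
      then obtain x where x: "x \<in> A" "c = block_color g m (f x) (h y)"
        using pal \<phi> y by auto
      have "f x div g < k" using f_less[OF x(1)] by (simp add: less_mult_imp_div_less)
      then have "(f x div g, (f x + h y) mod g) \<in> {..<k} \<times> {..<g}" using assms(1) by simp
      then show "c \<in> Q (h y div g)"
        unfolding Q_def x(2) block_color_def by (rule rev_image_eqI) simp
    qed
    \<comment> \<open>An upper bound suffices: the palette lies inside \<open>Q (h y div g)\<close>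
      and already has \<open>k * g\<close> elements.\<close>
    have "card (Q (h y div g)) \<le> card ({..<k} \<times> {..<g})"
      unfolding Q_def by (intro card_image_le) simp
    also have "\<dots> = card (palette ?E \<phi> y)"
      using card_palette_complete_bipartite[OF disj' y, of \<phi>] proper cA
      by (simp add: complete_bipartite_edges_commute[of A B])
    finally show "card (Q (h y div g)) \<le> card (palette ?E \<phi> y)" .
  qed (simp add: Q_def)
  have "palette ?E \<phi> ` (A \<union> B) \<subseteq> insert {..<m * g} (Q ` {..<m})"
    using palA palB h_less by (auto simp: less_mult_imp_div_less)
  then have "card (palette ?E \<phi> ` (A \<union> B)) \<le> card (insert {..<m * g} (Q ` {..<m}))"
    by (intro card_mono) auto
  also have "\<dots> \<le> Suc (card (Q ` {..<m}))"
    by (rule card_insert_le_m1) simp_all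
  also have "\<dots> \<le> 1 + m"
    using card_image_le[of "{..<m}" Q] by simp
  finally show ?thesis using proper by blast
qed

theorem theorem4p2:
  fixes a b :: nat and A B :: "'v set"
  assumes "0 < a" and "a < b"
    and "finite A" and "finite B" and "A \<inter> B = {}"
    and "card A = a" and "card B = b"
  shows "1 + \<lceil>real b / real a\<rceil> \<le> int (palette_index (A \<union> B) (complete_bipartite_edges A B))
    \<and> real (palette_index (A \<union> B) (complete_bipartite_edges A B)) \<le> 1 + real b / real (gcd a b)"
proof -
  let ?E = "complete_bipartite_edges A B"
  let ?S = "{card (palette ?E \<phi> ` (A \<union> B)) | \<phi>. proper_edge_coloring ?E \<phi>}"
  define g where "g = gcd a b"
  have g: "0 < g" using assms(1) by (simp add: g_def)
  obtain k where k: "a = k * g" using gcd_dvd1[of a b] by (auto simp: g_def dvd_def mult.commute)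
  obtain m where m: "b = m * g" using gcd_dvd2[of a b] by (auto simp: g_def dvd_def mult.commute)
  have "0 < k" using assms(1) k by simp
  moreover have "k \<le> m" using assms(2) k m by simp
  ultimately obtain \<phi> where \<phi>: "proper_edge_coloring ?E \<phi>"
    "card (palette ?E \<phi> ` (A \<union> B)) \<le> 1 + m"
    using card_palettes_complete_bipartite_le[OF g _ _ assms(3-5), of k m] assms(6,7) k m by blast
  then have mem: "card (palette ?E \<phi> ` (A \<union> B)) \<in> ?S" by blast
  \<comment> \<open>The constructed colouring also shows \<open>?S\<close> nonempty, so the infimum
    is attained by some \<open>\<psi>\<close>, to which the lower bound applies.\<close>
  then have "Inf ?S \<in> ?S" by (intro Inf_nat_def1) blast
  then obtain \<psi> where \<psi>: "proper_edge_coloring ?E \<psi>"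
    "palette_index (A \<union> B) ?E = card (palette ?E \<psi> ` (A \<union> B))"
    unfolding palette_index_def by blast
  have lower: "1 + \<lceil>real b / real a\<rceil> \<le> int (palette_index (A \<union> B) ?E)"
    using card_palettes_complete_bipartite_ge[OF _ _ assms(5) \<psi>(1)] assms \<psi>(2) by simp
  have "palette_index (A \<union> B) ?E \<le> card (palette ?E \<phi> ` (A \<union> B))"
    unfolding palette_index_def using mem by (rule wellorder_Inf_le1)
  with \<phi>(2) have "real (palette_index (A \<union> B) ?E) \<le> 1 + real m" by linarith
  also have "real m = real b / real g"
    using g m by simp
  finally show ?thesis using lower by (simp add: g_def)
qed

end
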